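(* Let $K$ be a field of characteristic $0$, let $N>n\geq 1$ be integers, let $f:K^n\to K^n$ be a cubic homogeneous map and let $F:K^N\to K^N$ be a cubic linear map. If $f$ and $F$ are paired (form a Gorni-Zampieri pair) and $F$ is nice, then $f$ is nice.
   Context: $K$ is a field of characteristic $0$. Here a cubic homogeneous map $f:K^n\to K^n$ is a polynomial map of the form $f(x)=x+h(x)$ with every component of $h$ zero or a homogeneous polynomial of degree $3$; a cubic linear map $F:K^N\to K^N$ is a polynomial map of the form $F_i(X)=X_i+\left(\sum_{j=1}^N a_{ij}X_j\right)^3$, $1\leq i\leq N$, for a matrix $A=(a_{ij})\in M_{N\times N}(K)$. The maps $f$ and $F$ are paired (form a Gorni-Zampieri pair) through matrices $B\in M_{n\times N}(K)$ and $C\in M_{N\times n}(K)$ if $f(x)=BF(Cx)$ for all $x\in K^n$, $BC=I_n$, and $\ker B=\ker A$; they are paired if such $B$ and $C$ exist. For a polynomial map $F=(F_1,\dots,F_d):K^d\to K^d$, define for $i=1,\dots,d$ the polynomials $P_0^i=X_i$ and, for $k\geq 1$, $P_k^i(X)=P_{k-1}^i(F(X))-P_{k-1}^i(X)$. The map $F$ is called nice if there exists an integer $m$ such that $P_m^i=0$ for all $i=1,\dots,d$. *)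

theory Defs
  imports "HOL-Analysis.Analysis" "HOL-Library.Poly_Mapping"
begin

text \<open>
  \<open>('k, 'n) mpol\<close> is the ring of formal polynomials over \<open>'k\<close> in the variables \<open>X\<^sub>i\<close>, \<open>i :: 'n\<close>:
  a finitely supported map from exponent vectors \<open>'n \<Rightarrow>\<^sub>0 nat\<close> to coefficients, with the
  convolution product.
\<close>

type_synonym ('k, 'n) mpol = "('n \<Rightarrow>\<^sub>0 nat) \<Rightarrow>\<^sub>0 'k"

definition mconst :: "'k::comm_ring_1 \<Rightarrow> ('k, 'n) mpol" where
  "mconst c = Poly_Mapping.single 0 c"

definition mvar :: "'n \<Rightarrow> ('k::comm_ring_1, 'n) mpol" where
  "mvar i = Poly_Mapping.single (Poly_Mapping.single i 1) 1"

definition mhomogeneous :: "nat \<Rightarrow> ('k::comm_ring_1, 'n::finite) mpol \<Rightarrow> bool" where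
  "mhomogeneous d p \<longleftrightarrow>
     (\<forall>m \<in> Poly_Mapping.keys p. (\<Sum>i\<in>UNIV. Poly_Mapping.lookup m i) = d)"

definition meval :: "('k::comm_ring_1, 'n::finite) mpol \<Rightarrow> 'k ^ 'n \<Rightarrow> 'k" where
  "meval p x = (\<Sum>m \<in> Poly_Mapping.keys p.
     Poly_Mapping.lookup p m * (\<Prod>i\<in>UNIV. (x $ i) ^ Poly_Mapping.lookup m i))"

text \<open>A polynomial map from \<open>'k ^ 'n\<close> to itself is given by its tuple of component polynomials.\<close>

type_synonym ('k, 'n) polymap = "('k, 'n) mpol ^ 'n"

definition map_eval :: "('k::comm_ring_1, 'n::finite) polymap \<Rightarrow> 'k ^ 'n \<Rightarrow> 'k ^ 'n" where
  "map_eval F x = (\<chi> i. meval (F $ i) x)"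

text \<open>Formal composition \<open>p(F(X))\<close>.\<close>

definition msubst ::
    "('k::comm_ring_1, 'n::finite) mpol \<Rightarrow> ('k, 'n) polymap \<Rightarrow> ('k, 'n) mpol" where
  "msubst p F = (\<Sum>m \<in> Poly_Mapping.keys p.
     mconst (Poly_Mapping.lookup p m) * (\<Prod>i\<in>UNIV. (F $ i) ^ Poly_Mapping.lookup m i))"

definition cubic_homogeneous_map :: "('k::comm_ring_1, 'n::finite) polymap \<Rightarrow> bool" where
  "cubic_homogeneous_map f \<longleftrightarrow>
     (\<exists>h :: ('k, 'n) polymap. \<forall>i. f $ i = mvar i + h $ i \<and> (h $ i = 0 \<or> mhomogeneous 3 (h $ i)))"

definition cubic_linear_map :: "'k::comm_ring_1 ^ 'n ^ 'n \<Rightarrow> ('k, 'n::finite) polymap" where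
  "cubic_linear_map A = (\<chi> i. mvar i + (\<Sum>j\<in>UNIV. mconst (A $ i $ j) * mvar j) ^ 3)"

text \<open>
  The cubic linear member of a pair enters through its matrix \<open>A\<close>, because the kernel
  condition refers to \<open>A\<close>.
\<close>

definition gz_paired_through ::
    "('k::field, 'n::finite) polymap \<Rightarrow> 'k ^ 'm ^ 'm \<Rightarrow> 'k ^ 'm ^ 'n \<Rightarrow> 'k ^ 'n ^ 'm::finite \<Rightarrow> bool" where
  "gz_paired_through f A B C \<longleftrightarrow>
     (\<forall>x. map_eval f x = B *v map_eval (cubic_linear_map A) (C *v x)) \<and>
     B ** C = mat 1 \<and>
     {X. B *v X = 0} = {X. A *v X = 0}"

definition gz_paired :: "('k::field, 'n::finite) polymap \<Rightarrow> 'k ^ 'm ^ 'm::finite \<Rightarrow> bool" where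
  "gz_paired f A \<longleftrightarrow> (\<exists>B C. gz_paired_through f A B C)"

primrec iter_diff ::
    "('k::comm_ring_1, 'n::finite) polymap \<Rightarrow> nat \<Rightarrow> 'n \<Rightarrow> ('k, 'n) mpol" where
  "iter_diff F 0 i = mvar i"
| "iter_diff F (Suc k) i = msubst (iter_diff F k i) F - iter_diff F k i"

definition nice :: "('k::comm_ring_1, 'n::finite) polymap \<Rightarrow> bool" where
  "nice F \<longleftrightarrow> (\<exists>m. \<forall>i. iter_diff F m i = 0)"

end

theory Submission
  imports Defs
begin

text \<open>
  Since \<open>X - CBX\<close> lies in \<open>ker B = ker A\<close>, the cubic part of \<open>F\<close> takes the same value at \<open>X\<close> and at
  \<open>CBX\<close>; hence \<open>BF(X) = f(BX)\<close>, i.e. \<open>B\<close> semiconjugates \<open>F\<close> to \<open>f\<close>. The difference operators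
  defining niceness then satisfy \<open>P\<^sub>k\<^sup>f(BX) = B P\<^sub>k\<^sup>F(X)\<close>, so \<open>P\<^sub>m\<^sup>F = 0\<close> forces \<open>P\<^sub>m\<^sup>f\<close> to vanish on the
  image of \<open>B\<close>, which is everything. Over an infinite field it is then the zero polynomial.
\<close>

text \<open>Monomials outside the support contribute zero. This lets \<open>p\<close>,
  \<open>q\<close> and \<open>p + q\<close> be evaluated over one common index set.\<close>

lemma meval_superset:
  assumes "finite M" "Poly_Mapping.keys p \<subseteq> M"
  shows "meval p x = (\<Sum>m\<in>M. Poly_Mapping.lookup p m * (\<Prod>i\<in>UNIV. (x $ i) ^ Poly_Mapping.lookup m i))"
  unfolding meval_def using assms
  by (intro sum.mono_neutral_left) (auto simp: in_keys_iff)

lemma meval_zero [simp]: "meval 0 x = 0"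
  by (simp add: meval_def)

lemma meval_add [simp]: "meval (p + q) x = meval p x + meval q x"
proof -
  let ?M = "Poly_Mapping.keys p \<union> Poly_Mapping.keys q"
  show ?thesis
    using meval_superset[of ?M p x] meval_superset[of ?M q x] meval_superset[of ?M "p + q" x]
      Poly_Mapping.keys_add[of p q]
    by (simp add: lookup_add distrib_right sum.distrib)
qed

lemma meval_diff [simp]: "meval (p - q) x = meval p x - meval q x"
  using meval_add[of "p - q" q x] by (simp add: eq_diff_eq)

lemma meval_sum [simp]: "meval (\<Sum>a\<in>S. p a) x = (\<Sum>a\<in>S. meval (p a) x)"
  by (induction S rule: infinite_finite_induct) simp_all

lemma meval_single:
  "meval (Poly_Mapping.single m c) x = c * (\<Prod>i\<in>UNIV. (x $ i) ^ Poly_Mapping.lookup m i)"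
  by (subst meval_superset[of "{m}"]) auto

lemma meval_mconst [simp]: "meval (mconst c) x = c"
  by (simp add: mconst_def meval_single)

lemma meval_mvar [simp]: "meval (mvar i) x = x $ i"
proof -
  have "(x $ j) ^ Poly_Mapping.lookup (Poly_Mapping.single i 1) j = (if i = j then x $ i else 1)" for j
    by (simp add: lookup_single when_def)
  then show ?thesis
    by (simp add: mvar_def meval_single)
qed

text \<open>By bilinearity the claim reduces to single monomials, whose exponents add under
  multiplication.\<close>

lemma meval_mult [simp]: "meval (p * q) x = meval p x * meval q x"
proof -
  have expand: "r = (\<Sum>m\<in>Poly_Mapping.keys r. Poly_Mapping.single m (Poly_Mapping.lookup r m))"
    for r :: "('a, 'b) mpol"
    by (rule poly_mapping_eqI)
      (auto simp: lookup_sum lookup_single when_def in_keys_iff)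
  have monomial: "meval (Poly_Mapping.single k a * Poly_Mapping.single l b) x =
      meval (Poly_Mapping.single k a) x * meval (Poly_Mapping.single l b) x" for k l a b
    by (simp add: mult_single meval_single lookup_add power_add prod.distrib mult_ac)
  show ?thesis
    by (subst (1 2 3 4) expand) (simp only: sum_product meval_sum monomial)
qed

lemma meval_one [simp]: "meval 1 x = 1"
  using meval_mconst[of 1 x] by (simp add: mconst_def)

lemma meval_power [simp]: "meval (p ^ k) x = meval p x ^ k"
  by (induction k) simp_all

lemma meval_prod [simp]: "meval (\<Prod>a\<in>S. p a) x = (\<Prod>a\<in>S. meval (p a) x)"
  by (induction S rule: infinite_finite_induct) simp_all

lemma meval_msubst [simp]: "meval (msubst p F) x = meval p (map_eval F x)"
  by (simp add: msubst_def meval_def[of p] map_eval_def)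

lemma map_eval_cubic_linear_map:
  "map_eval (cubic_linear_map A) x = x + (\<chi> i. ((A *v x) $ i) ^ 3)"
  by (simp add: vec_eq_iff map_eval_def cubic_linear_map_def matrix_vector_mult_def)

text \<open>Induction on the set of variables, splitting off one variable at a time. Exponents are
  total functions, so injectivity of restriction to \<open>S\<close> is what makes the monomials in
  \<open>M\<close> distinct.\<close>

lemma monomial_combination_zero:
  fixes c :: "('i \<Rightarrow> nat) \<Rightarrow> 'k::{idom, ring_char_0}"
  assumes "finite S" "finite M"
    and "inj_on (\<lambda>m. restrict m S) M"
    and "\<And>x :: 'i \<Rightarrow> 'k. (\<Sum>m\<in>M. c m * (\<Prod>i\<in>S. x i ^ m i)) = 0"
    and "m \<in> M"
  shows "c m = 0"
  using assms
proof (induction S arbitrary: M m rule: finite_induct)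
  case empty
  \<comment> \<open>All restrictions to the empty set coincide, so the sum has a single term,
    \<open>c m\<close>.\<close>
  then have "M = {m}"
    by (auto simp: inj_on_def)
  then show ?case
    using empty.prems(3) by simp
next
  case (insert a S)
  \<comment> \<open>These monomials make up the coefficient of degree \<open>m a\<close> in the
    variable \<open>a\<close>; on them the exponent of \<open>a\<close> is fixed, so they still
    differ on \<open>S\<close>.\<close>
  let ?M = "{l \<in> M. l a = m a}"
  have inj: "inj_on (\<lambda>l. restrict l S) ?M"
  proof (rule inj_onI)
    fix l l' assume l: "l \<in> ?M" "l' \<in> ?M" "restrict l S = restrict l' S"
    have "restrict l (insert a S) = restrict l' (insert a S)"
    proof
      fix i show "restrict l (insert a S) i = restrict l' (insert a S) i"
        using l(1,2) fun_cong[OF l(3), of i] by (cases "i \<in> S") auto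
    qed
    then show "l = l'"
      using l inj_onD[OF insert.prems(2)] by blast
  qed
  have vanish: "(\<Sum>l\<in>?M. c l * (\<Prod>i\<in>S. x i ^ l i)) = 0" for x :: "'i \<Rightarrow> 'k"
  proof -
    \<comment> \<open>The other variables are frozen at \<open>x\<close>, leaving a univariate
      polynomial in the variable \<open>a\<close>. It vanishes everywhere on an infinite domain, so
      each coefficient is zero.\<close>
    define p where "p = (\<Sum>l\<in>M. monom (c l * (\<Prod>i\<in>S. x i ^ l i)) (l a))"
    have "poly p t = 0" for t
    proof -
      have "(\<Prod>i\<in>S. (x(a := t)) i ^ l i) = (\<Prod>i\<in>S. x i ^ l i)" for l
        using insert.hyps by (intro prod.cong) auto
      then have "poly p t = (\<Sum>l\<in>M. c l * (\<Prod>i\<in>insert a S. (x(a := t)) i ^ l i))"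
        using insert.hyps by (simp add: p_def poly_sum poly_monom mult_ac)
      then show ?thesis
        using insert.prems(3) by simp
    qed
    then have "p = 0"
      using poly_all_0_iff_0 by blast
    then have "coeff p (m a) = 0"
      by simp
    then show ?thesis
      using insert.prems(1) by (simp add: p_def coeff_sum sum.inter_filter)
  qed
  show ?case
    by (rule insert.IH[OF _ inj vanish]) (use insert.prems in auto)
qed

lemma meval_all_zero_imp_zero:
  fixes p :: "('k::{idom, ring_char_0}, 'n::finite) mpol"
  assumes "\<And>x. meval p x = 0"
  shows "p = 0"
proof (rule poly_mapping_eqI)
  fix m
  let ?M = "Poly_Mapping.lookup ` Poly_Mapping.keys p"
  \<comment> \<open>On \<open>?M\<close> the map \<open>Abs_poly_mapping\<close> inverts
    \<open>lookup\<close>, so \<open>c\<close> reads off the coefficients of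
    \<open>p\<close>.\<close>
  define c where "c l = Poly_Mapping.lookup p (Abs_poly_mapping l)" for l
  have inj: "inj_on Poly_Mapping.lookup (Poly_Mapping.keys p)"
    by (auto intro: inj_onI poly_mapping_eqI)
  have "c l = 0" if "l \<in> ?M" for l
  proof (rule monomial_combination_zero[of UNIV ?M])
    fix x :: "'n \<Rightarrow> 'k"
    show "(\<Sum>l\<in>?M. c l * (\<Prod>i\<in>UNIV. x i ^ l i)) = 0"
      using assms[of "\<chi> i. x i"] by (simp add: sum.reindex[OF inj] meval_def c_def)
  qed (use that in \<open>auto simp: inj_on_def restrict_def\<close>)
  then have "Poly_Mapping.lookup p m = 0" if "m \<in> Poly_Mapping.keys p"
    using that by (force simp: c_def)
  then show "Poly_Mapping.lookup p m = Poly_Mapping.lookup 0 m"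
    by (auto simp: in_keys_iff)
qed

lemma gz_paired_through_semiconjugate:
  assumes "gz_paired_through f A B C"
  shows "map_eval f (B *v X) = B *v map_eval (cubic_linear_map A) X"
proof -
  from assms have f: "\<And>x. map_eval f x = B *v map_eval (cubic_linear_map A) (C *v x)"
    and BC: "B ** C = mat 1" and ker: "{X. B *v X = 0} = {X. A *v X = 0}"
    by (auto simp: gz_paired_through_def)
  have BCB: "B *v (C *v (B *v X)) = B *v X"
    by (metis BC matrix_vector_mul_assoc matrix_vector_mul_lid)
  then have "B *v (X - C *v (B *v X)) = 0"
    by (simp add: matrix_vector_mult_diff_distrib)
  then have "A *v (X - C *v (B *v X)) = 0"
    using ker by blast
  then have "A *v (C *v (B *v X)) = A *v X"
    by (simp add: matrix_vector_mult_diff_distrib)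
  \<comment> \<open>The cubic parts at \<open>X\<close> and at \<open>C *v (B *v X)\<close> now
    agree; the linear parts agree after applying \<open>B\<close>, by \<open>BCB\<close>.\<close>
  then show ?thesis
    by (simp add: f map_eval_cubic_linear_map matrix_vector_right_distrib BCB)
qed

text \<open>Substituting \<open>f\<close> at \<open>B *v X\<close> amounts to moving to
  \<open>B *v map_eval F X\<close>, so the induction hypothesis is needed at both \<open>X\<close>
  and \<open>map_eval F X\<close>. The entries of \<open>B\<close> are constants and pass through
  the difference.\<close>

lemma meval_iter_diff_semiconjugate:
  assumes "\<And>X. map_eval f (B *v X) = B *v map_eval F X"
  shows "meval (iter_diff f k i) (B *v X) = (\<Sum>j\<in>UNIV. B $ i $ j * meval (iter_diff F k j) X)"
proof (induction k arbitrary: X)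
  case 0
  then show ?case
    by (simp add: matrix_vector_mult_def)
next
  case (Suc k)
  then show ?case
    by (simp add: assms right_diff_distrib sum_subtractf)
qed

theorem corollary13:
  fixes f :: "('k::field_char_0, 'n::finite) polymap"
    and F :: "('k, 'm::finite) polymap"
    and A :: "'k ^ 'm ^ 'm"
  assumes "CARD('n) < CARD('m)"
    and "cubic_homogeneous_map f"
    and "F = cubic_linear_map A"
    and "gz_paired f A"
    and "nice F"
  shows "nice f"
proof -
  obtain B C where BC: "gz_paired_through f A B C"
    using assms(4) by (auto simp: gz_paired_def)
  obtain m where m: "\<And>i. iter_diff F m i = 0"
    using assms(5) by (auto simp: nice_def)
  have "iter_diff f m i = 0" for i
  proof (rule meval_all_zero_imp_zero)
    fix x
    \<comment> \<open>The right inverse \<open>C\<close> supplies a preimage of every point under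
      \<open>B\<close>.\<close>
    have "B *v (C *v x) = x"
      using BC by (simp add: gz_paired_through_def matrix_vector_mul_assoc)
    then show "meval (iter_diff f m i) x = 0"
      using meval_iter_diff_semiconjugate[of f B F m i "C *v x"]
        gz_paired_through_semiconjugate[OF BC] by (simp add: m flip: assms(3))
  qed
  then show ?thesis
    by (auto simp: nice_def)
qed

end
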